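(* Fix an $N\times M$ matrix $\mathbf p$ with positive entries and an $N\times M$ matrix $\mathbf q$ with non-negative entries. For $i=1,\dots,N$, $j=1,\dots,M$ let $d_{ij}(\mathbf P,\mathbf p,\mathbf q)\ge 0$ and $c_{ij}(\mathbf P,\mathbf p,\mathbf q)\ge 0$ be functions that are continuous in $\mathbf P\in\mathbb R_{\ge0}^N\setminus\{\mathbf 0\}$ and homogeneous in $\mathbf P$, all of the same degree, and that satisfy the non-degeneracy assumptions listed in the context. Consider the system $$\frac{1}{PPP_j}=\sum_{n=1}^{N}\frac{d_{nj}(\mathbf P,\mathbf p,\mathbf q)}{\sum_{k=1}^{N}c_{kj}(\mathbf P,\mathbf p,\mathbf q)}\,P_n\quad(j=1,\dots,M),\qquad P_i=\sum_{m=1}^{M}\frac{c_{im}(\mathbf P,\mathbf p,\mathbf q)}{\sum_{k=1}^{M}d_{ik}(\mathbf P,\mathbf p,\mathbf q)}\,\frac{1}{PPP_m}\quad(i=1,\dots,N),$$ regarded as a system in the unknowns $1/PPP_j$ and $P_i$. Define $\mathbf G=(G_1,\dots,G_N)$ by $$G_i(\mathbf P)=\frac{\sum_{m=1}^{M}c_{im}(\mathbf P,\mathbf p,\mathbf q)\sum_{n=1}^{N}\dfrac{d_{nm}(\mathbf P,\mathbf p,\mathbf q)}{\sum_{k=1}^{N}c_{km}(\mathbf P,\mathbf p,\mathbf q)}P_n}{\sum_{m=1}^{M}d_{im}(\mathbf P,\mathbf p,\mathbf q)}\qquad(i=1,\dots,N).$$ Then: (i) the system has at least one non-negative solution with some positive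 elements (up to a positive scalar multiple); (ii) if $\mathbf G$ is monotone and strongly connected, the system has at least one positive solution (up to a positive scalar multiple); (iii) if $\mathbf G$ is monotone and indecomposable, the system has a unique positive solution (up to a positive scalar multiple).
   Context: Non-degeneracy assumptions: for every $\mathbf P\in\mathbb R_{\ge 0}^N\setminus\{\mathbf 0\}$, $\sum_{i}c_{ij}(\mathbf P,\mathbf p,\mathbf q)>0$ for each $j$ and $\sum_{j}d_{ij}(\mathbf P,\mathbf p,\mathbf q)>0$ for each $i$; and for every strictly positive $\mathbf P$, also $\sum_i d_{ij}(\mathbf P,\mathbf p,\mathbf q)>0$ for each $j$ and $\sum_j c_{ij}(\mathbf P,\mathbf p,\mathbf q)>0$ for each $i$. Thus $\mathbf G$ is defined on $\mathbb R_{\ge0}^N\setminus\{\mathbf 0\}$ and maps strictly positive vectors to strictly positive vectors; set $\mathbf G(\mathbf 0)=\mathbf 0$. Solutions are vectors of values $(1/PPP_1,\dots,1/PPP_M,P_1,\dots,P_N)$ satisfying the equations with $\mathbf P\neq\mathbf 0$; "non-negative with some positive elements" means all these values are $\ge 0$ and $\mathbf P\ne \mathbf 0$; "positive" means all are $>0$. A positive scalar multiple of a solution (in these variables) is again a solution; "unique up to a positive scalar multiple" means that any two positive solutions are positive multiples of each other in these variables. Monotonicity: $\mathbf x\ge\mathbf y\ge \mathbf 0$ (componentwise) implies $G_i(\mathbf x)\ge G_i(\mathbf y)$ for all $i$. Strong connectedness of $\mathbf G$: let $\Theta(\mathbf G)$ be the directed graph with vertices $1,\dots,N$ and an edge from $i$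 to $j$ if and only if $\lim_{x_j\to\infty}G_i(\mathbf x_{\{j\}})=\infty$, where $\mathbf x_{\{j\}}$ is the vector with all entries equal to $1$ except its $j$-th entry, which is $x_j$. $\mathbf G$ is strongly connected if for every ordered pair of vertices there is a directed path in $\Theta(\mathbf G)$ from the first to the second. Indecomposability of $\mathbf G$: for every pair of vectors $\mathbf x\ge\mathbf y\ge\mathbf 0$ for which $\Omega=\{j: x_j>y_j\}$ is a nonempty proper subset of $\{1,\dots,N\}$, there exists $k\notin\Omega$ with $G_k(\mathbf x)\neq G_k(\mathbf y)$. *)

theory Defs
  imports "HOL-Analysis.Analysis"
begin

text \<open>
  The index types \<open>'n\<close> and \<open>'m\<close> stand for \<open>{1,\<dots>,N}\<close> and \<open>{1,\<dots>,M}\<close>.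
  The inequality \<open>\<le>\<close> on \<^typ>\<open>real ^ 'n\<close> is the componentwise one; the corresponding \<open><\<close> is
  not, so strict positivity is always stated entry by entry.
\<close>

type_synonym ('n, 'm) coeff_family =
  "'n \<Rightarrow> 'm \<Rightarrow> real ^ 'n \<Rightarrow> real ^ 'm ^ 'n \<Rightarrow> real ^ 'm ^ 'n \<Rightarrow> real"

definition price_domain :: "(real ^ 'n) set" where
  "price_domain = {P. 0 \<le> P \<and> P \<noteq> 0}"

definition homogeneous_on_prices ::
  "real \<Rightarrow> ('n::finite, 'm::finite) coeff_family \<Rightarrow> real ^ 'm ^ 'n \<Rightarrow> real ^ 'm ^ 'n \<Rightarrow> bool" where
  "homogeneous_on_prices r f p q \<longleftrightarrow>
     (\<forall>i j. \<forall>P \<in> price_domain. \<forall>t>0. f i j (t *\<^sub>R P) p q = t powr r * f i j P p q)"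

definition nondegenerate ::
  "('n::finite, 'm::finite) coeff_family \<Rightarrow> ('n, 'm) coeff_family \<Rightarrow>
     real ^ 'm ^ 'n \<Rightarrow> real ^ 'm ^ 'n \<Rightarrow> bool" where
  "nondegenerate c d p q \<longleftrightarrow>
     (\<forall>P \<in> price_domain.
        (\<forall>j. (\<Sum>i\<in>UNIV. c i j P p q) > 0) \<and> (\<forall>i. (\<Sum>j\<in>UNIV. d i j P p q) > 0)) \<and>
     (\<forall>P. (\<forall>i. P $ i > 0) \<longrightarrow>
        (\<forall>j. (\<Sum>i\<in>UNIV. d i j P p q) > 0) \<and> (\<forall>i. (\<Sum>j\<in>UNIV. c i j P p q) > 0))"

text \<open>The entry \<open>u $ j\<close> is the unknown \<open>1/PPP\<^sub>j\<close>; it may be zero.\<close>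

definition is_solution ::
  "('n::finite, 'm::finite) coeff_family \<Rightarrow> ('n, 'm) coeff_family \<Rightarrow>
     real ^ 'm ^ 'n \<Rightarrow> real ^ 'm ^ 'n \<Rightarrow> real ^ 'm \<Rightarrow> real ^ 'n \<Rightarrow> bool" where
  "is_solution c d p q u P \<longleftrightarrow>
     P \<noteq> 0 \<and>
     (\<forall>j. u $ j = (\<Sum>n\<in>UNIV. d n j P p q / (\<Sum>k\<in>UNIV. c k j P p q) * P $ n)) \<and>
     (\<forall>i. P $ i = (\<Sum>m\<in>UNIV. c i m P p q / (\<Sum>k\<in>UNIV. d i k P p q) * u $ m))"

definition nonneg_solution ::
  "('n::finite, 'm::finite) coeff_family \<Rightarrow> ('n, 'm) coeff_family \<Rightarrow>
     real ^ 'm ^ 'n \<Rightarrow> real ^ 'm ^ 'n \<Rightarrow> real ^ 'm \<Rightarrow> real ^ 'n \<Rightarrow> bool" where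
  "nonneg_solution c d p q u P \<longleftrightarrow>
     is_solution c d p q u P \<and> (\<forall>j. u $ j \<ge> 0) \<and> (\<forall>i. P $ i \<ge> 0)"

definition positive_solution ::
  "('n::finite, 'm::finite) coeff_family \<Rightarrow> ('n, 'm) coeff_family \<Rightarrow>
     real ^ 'm ^ 'n \<Rightarrow> real ^ 'm ^ 'n \<Rightarrow> real ^ 'm \<Rightarrow> real ^ 'n \<Rightarrow> bool" where
  "positive_solution c d p q u P \<longleftrightarrow>
     is_solution c d p q u P \<and> (\<forall>j. u $ j > 0) \<and> (\<forall>i. P $ i > 0)"

definition G_map ::
  "('n::finite, 'm::finite) coeff_family \<Rightarrow> ('n, 'm) coeff_family \<Rightarrow>
     real ^ 'm ^ 'n \<Rightarrow> real ^ 'm ^ 'n \<Rightarrow> real ^ 'n \<Rightarrow> real ^ 'n" where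
  "G_map c d p q P =
     (if P = 0 then 0
      else \<chi> i. (\<Sum>m\<in>UNIV. c i m P p q *
                   (\<Sum>n\<in>UNIV. d n m P p q / (\<Sum>k\<in>UNIV. c k m P p q) * P $ n))
                / (\<Sum>m\<in>UNIV. d i m P p q))"

definition monotone_on_orthant :: "(real ^ 'n \<Rightarrow> real ^ 'n) \<Rightarrow> bool" where
  "monotone_on_orthant G \<longleftrightarrow> mono_on {x. 0 \<le> x} G"

definition Theta :: "(real ^ 'n \<Rightarrow> real ^ 'n) \<Rightarrow> ('n::finite) rel" where
  "Theta G = {(i, j). filterlim (\<lambda>t. G (\<chi> k. if k = j then t else 1) $ i) at_top at_top}"

definition strongly_connected_map :: "(real ^ 'n \<Rightarrow> real ^ 'n) \<Rightarrow> bool" where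
  "strongly_connected_map G \<longleftrightarrow> (\<forall>i j. (i, j) \<in> (Theta G)\<^sup>*)"

definition indecomposable_map :: "(real ^ 'n \<Rightarrow> real ^ 'n) \<Rightarrow> bool" where
  "indecomposable_map G \<longleftrightarrow>
     (\<forall>x y. 0 \<le> y \<and> y \<le> x \<longrightarrow>
        (let \<Omega> = {j. x $ j > y $ j} in
           \<Omega> \<noteq> {} \<and> \<Omega> \<noteq> UNIV \<longrightarrow> (\<exists>k. k \<notin> \<Omega> \<and> G x $ k \<noteq> G y $ k)))"

end

theory Submission imports Defs begin

text \<open>
  Eliminating the unknowns \<open>u\<close>, the solutions are the fixed points of \<open>G\<close>.  Weighting by
  \<open>D\<^sub>i = \<Sum>\<^sub>m d\<^sub>i\<^sub>m\<close> gives the conservation law \<open>\<Sum>\<^sub>i D\<^sub>i G\<^sub>i(P) = \<Sum>\<^sub>i D\<^sub>i P\<^sub>i\<close>, so \<open>G\<close> has no eigenvalue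
  other than 1 on the orthant and any nonlinear eigenvector is a solution.  Brouwer's theorem for
  the normalised map on the simplex yields one.  For strongly connected \<open>G\<close>, the eigenvectors of the
  perturbations \<open>G + e\<close> are positive, and monotonicity along paths of \<open>Theta G\<close> bounds the ratios of
  their entries independently of \<open>e\<close>, so a compactness argument applies.  For indecomposable \<open>G\<close>,
  comparing a fixed point with 0 shows that it is positive, and comparing two of them at the minimal
  ratio of their entries shows that they are proportional.
\<close>

section \<open>The price simplex and Brouwer's theorem\<close>

definition price_simplex :: "(real ^ 'n::finite) set" where
  "price_simplex = {P. 0 \<le> P \<and> (\<Sum>i\<in>UNIV. P $ i) = 1}"

lemma price_simplex_subset_domain: "price_simplex \<subseteq> price_domain"
proof
  fix P :: "real ^ 'n"
  assume P: "P \<in> price_simplex"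
  have "(\<Sum>i\<in>UNIV. (0 :: real ^ 'n) $ i) \<noteq> 1" unfolding zero_index by simp
  then have "P \<noteq> 0" using P unfolding price_simplex_def by blast
  then show "P \<in> price_domain" using P unfolding price_simplex_def price_domain_def by blast
qed

lemma positive_in_domain:
  assumes pos: "\<And>i. 0 < P $ i"
  shows "P \<in> price_domain"
proof -
  have "P \<noteq> 0" using pos[of undefined] by auto
  moreover have "0 \<le> P $ i" for i using pos[of i] by simp
  then have "0 \<le> P" by (simp add: less_eq_vec_def)
  ultimately show ?thesis by (simp add: price_domain_def)
qed

lemma price_simplex_le_1:
  assumes "P \<in> price_simplex"
  shows "P $ i \<le> 1"
proof -
  have "P $ i \<le> (\<Sum>i\<in>UNIV. P $ i)"
    using assms by (intro member_le_sum) (auto simp: price_simplex_def less_eq_vec_def)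
  then show ?thesis using assms by (simp add: price_simplex_def)
qed

lemma closed_orthant: "closed {P :: real ^ 'n::finite. 0 \<le> P}"
  unfolding less_eq_vec_def
  by (intro closed_Collect_all closed_Collect_le continuous_intros)

lemma compact_price_simplex: "compact (price_simplex :: (real ^ 'n::finite) set)"
proof -
  have "closed (price_simplex :: (real ^ 'n) set)"
    unfolding price_simplex_def
    by (intro closed_Collect_conj closed_orthant closed_Collect_eq continuous_intros)
  moreover have "price_simplex \<subseteq> {0 .. (1 :: real ^ 'n)}"
    using price_simplex_le_1 unfolding less_eq_vec_def
    by (fastforce simp: price_simplex_def less_eq_vec_def)
  then have "bounded (price_simplex :: (real ^ 'n) set)"
    by (metis bounded_cbox bounded_subset interval_cbox_cart interval_cbox)
  ultimately show ?thesis by (simp add: compact_eq_bounded_closed)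
qed

lemma convex_price_simplex: "convex (price_simplex :: (real ^ 'n::finite) set)"
proof (rule convexI)
  fix x y :: "real ^ 'n" and u v :: real
  assume x: "x \<in> price_simplex" and y: "y \<in> price_simplex"
    and uv: "0 \<le> u" "0 \<le> v" "u + v = 1"
  have "(\<Sum>i\<in>UNIV. (u *\<^sub>R x + v *\<^sub>R y) $ i) = u * (\<Sum>i\<in>UNIV. x $ i) + v * (\<Sum>i\<in>UNIV. y $ i)"
    by (simp add: sum.distrib sum_distrib_left)
  then show "u *\<^sub>R x + v *\<^sub>R y \<in> price_simplex"
    using x y uv by (simp add: price_simplex_def less_eq_vec_def)
qed

lemma price_simplex_nonempty: "(price_simplex :: (real ^ 'n::finite) set) \<noteq> {}"
proof -
  have "(\<chi> i. 1 / real CARD('n)) \<in> (price_simplex :: (real ^ 'n) set)"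
    by (auto simp: price_simplex_def less_eq_vec_def)
  then show ?thesis by blast
qed

text \<open>Dividing \<open>F P\<close> by its entry sum, which is positive, gives a continuous
  self-map of the simplex; a Brouwer fixed point of it is an eigenvector with that sum as
  eigenvalue.\<close>

lemma nonneg_eigenvector_exists:
  fixes F :: "real ^ 'n::finite \<Rightarrow> real ^ 'n"
  assumes cont: "continuous_on price_simplex F"
    and nonneg: "\<And>P. P \<in> price_simplex \<Longrightarrow> 0 \<le> F P"
    and nonzero: "\<And>P. P \<in> price_simplex \<Longrightarrow> F P \<noteq> 0"
  shows "\<exists>P \<in> price_simplex. F P = (\<Sum>i\<in>UNIV. F P $ i) *\<^sub>R P"
proof -
  let ?s = "\<lambda>P. \<Sum>i\<in>UNIV. F P $ i"
  have s_pos: "?s P > 0" if P: "P \<in> price_simplex" for P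
  proof -
    obtain i where "F P $ i \<noteq> 0" using nonzero[OF P] by (auto simp: vec_eq_iff)
    then have "F P $ i > 0" using nonneg[OF P] by (auto simp: less_eq_vec_def order_less_le)
    then show ?thesis
      using nonneg[OF P] by (intro sum_pos2[of _ i]) (auto simp: less_eq_vec_def)
  qed
  have "continuous_on price_simplex (\<lambda>P. inverse (?s P) *\<^sub>R F P)"
    using s_pos by (intro continuous_intros cont) (metis less_irrefl)
  moreover have "(\<lambda>P. inverse (?s P) *\<^sub>R F P) \<in> price_simplex \<rightarrow> price_simplex"
  proof
    fix P :: "real ^ 'n"
    assume P: "P \<in> price_simplex"
    show "inverse (?s P) *\<^sub>R F P \<in> price_simplex"
      using s_pos[OF P] nonneg[OF P]
      by (auto simp: price_simplex_def less_eq_vec_def simp flip: sum_distrib_left)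
  qed
  ultimately obtain P where P: "P \<in> price_simplex" "inverse (?s P) *\<^sub>R F P = P"
    by (rule brouwer[OF compact_price_simplex convex_price_simplex price_simplex_nonempty])
  define s where "s = ?s P"
  have "s \<noteq> 0" "inverse s *\<^sub>R F P = P" using s_pos[OF P(1)] P(2) by (simp_all add: s_def)
  then have "F P = s *\<^sub>R P" by (metis scaleR_scaleR right_inverse scaleR_one)
  then show ?thesis using P(1) unfolding s_def by blast
qed

section \<open>Positive eigenvectors of monotone, strongly connected homogeneous maps\<close>

locale homogeneous_map =
  fixes G :: "real ^ 'n::finite \<Rightarrow> real ^ 'n"
  assumes scale: "\<And>P t. P \<in> price_domain \<Longrightarrow> t > 0 \<Longrightarrow> G (t *\<^sub>R P) = t *\<^sub>R G P"
    and cont: "continuous_on price_domain G"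
    and nonneg: "\<And>P. P \<in> price_domain \<Longrightarrow> 0 \<le> G P"
begin

text \<open>Induction along the path. Across an edge from \<open>j\<close> to \<open>l\<close>, a
  value of \<open>P $ l\<close> too large relative to \<open>m\<close> would force
  \<open>G P $ j\<close> above \<open>K * P $ j\<close>, by monotonicity, homogeneity and the
  divergence defining \<open>Theta\<close>. The constant may depend on the path and on
  \<open>K\<close>, but not on \<open>P\<close> or \<open>m\<close>.\<close>

lemma Theta_rtrancl_bound:
  assumes mono: "monotone_on_orthant G" and path: "(i, j) \<in> (Theta G)\<^sup>*"
  shows "\<exists>B. \<forall>P m. m > 0 \<longrightarrow> (\<forall>k. m \<le> P $ k) \<longrightarrow> (\<forall>k. G P $ k \<le> K * P $ k) \<longrightarrow>
           P $ i \<le> m \<longrightarrow> P $ j \<le> B * m"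
  using path
proof induction
  case base
  show ?case by (rule exI[of _ 1]) simp
next
  case (step j l)
  then obtain B where B: "\<And>P m. m > 0 \<Longrightarrow> (\<And>k. m \<le> P $ k) \<Longrightarrow> (\<And>k. G P $ k \<le> K * P $ k) \<Longrightarrow>
      P $ i \<le> m \<Longrightarrow> P $ j \<le> B * m" by metis
  let ?e = "\<lambda>t. (\<chi> k. if k = l then t else 1) :: real ^ 'n"
  have "filterlim (\<lambda>t. G (?e t) $ j) at_top at_top"
    using step.hyps(2) by (simp add: Theta_def)
  \<comment> \<open>With \<open>\<bar>K\<bar>\<close> in place of \<open>K\<close>, the bound on
    \<open>P $ j\<close> can be multiplied by it whatever the sign of \<open>K\<close>.\<close>
  then have "eventually (\<lambda>t. G (?e t) $ j > \<bar>K\<bar> * B) at_top"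
    by (simp add: filterlim_at_top_dense)
  then obtain T where T: "\<And>t. t \<ge> T \<Longrightarrow> G (?e t) $ j > \<bar>K\<bar> * B"
    by (auto simp: eventually_at_top_linorder)
  show ?case
  proof (intro exI[of _ T] allI impI)
    fix P :: "real ^ 'n" and m :: real
    assume m: "m > 0" and le: "\<forall>k. m \<le> P $ k" and sub: "\<forall>k. G P $ k \<le> K * P $ k"
      and i: "P $ i \<le> m"
    show "P $ l \<le> T * m"
    proof (rule ccontr)
      assume "\<not> P $ l \<le> T * m"
      \<comment> \<open>This ratio makes \<open>m *\<^sub>R ?e t\<close> agree with \<open>P\<close>
        at \<open>l\<close> and equal the lower bound \<open>m\<close> at all other indices.\<close>
      define t where "t = P $ l / m"
      have t: "t \<ge> T" "t \<ge> 1" "m * t = P $ l"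
        using \<open>\<not> P $ l \<le> T * m\<close> m le by (auto simp: t_def field_simps)
      have dom: "?e t \<in> price_domain"
        using t(2) by (auto simp: price_domain_def less_eq_vec_def vec_eq_iff)
      have below: "m *\<^sub>R ?e t \<le> P" using le t(3) by (auto simp: less_eq_vec_def)
      have "0 \<le> m *\<^sub>R ?e t" using m t(2) by (auto simp: less_eq_vec_def)
      then have "G (m *\<^sub>R ?e t) \<le> G P"
        using below by (blast intro: mono_onD[OF mono[unfolded monotone_on_orthant_def]] order.trans)
      then have "m * G (?e t) $ j \<le> G P $ j"
        using scale[OF dom m] by (simp add: less_eq_vec_def)
      also have "\<dots> \<le> K * P $ j" using sub by simp
      also have "\<dots> \<le> \<bar>K\<bar> * P $ j"
        using m le by (intro mult_right_mono) (auto intro: order.trans[of 0 m])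
      also have "\<dots> \<le> \<bar>K\<bar> * (B * m)"
        using B[OF m] le sub i by (intro mult_left_mono) auto
      finally have "m * G (?e t) $ j \<le> m * (\<bar>K\<bar> * B)" by (simp add: mult_ac)
      then show False using T[OF t(1)] m by simp
    qed
  qed
qed

text \<open>Every index is reached by a path from the index of a smallest entry, so each entry is at
  most a constant multiple of the smallest one.\<close>

lemma strongly_connected_entries_comparable:
  assumes mono: "monotone_on_orthant G" and conn: "strongly_connected_map G"
  shows "\<exists>B>0. \<forall>P. (\<forall>k. 0 < P $ k) \<longrightarrow> (\<forall>k. G P $ k \<le> K * P $ k) \<longrightarrow>
           (\<forall>i j. P $ j \<le> B * P $ i)"
proof -
  have "\<forall>i j. \<exists>B. \<forall>P m. m > 0 \<longrightarrow> (\<forall>k. m \<le> P $ k) \<longrightarrow> (\<forall>k. G P $ k \<le> K * P $ k) \<longrightarrow>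
           P $ i \<le> m \<longrightarrow> P $ j \<le> B * m"
    using Theta_rtrancl_bound[OF mono] conn unfolding strongly_connected_map_def by blast
  then obtain B where B: "\<And>i j P m. m > 0 \<Longrightarrow> (\<And>k. m \<le> P $ k) \<Longrightarrow>
      (\<And>k. G P $ k \<le> K * P $ k) \<Longrightarrow> P $ i \<le> m \<Longrightarrow> P $ j \<le> B i j * m"
    by metis
  \<comment> \<open>The sum dominates every \<open>B i j\<close>; the extra 1 keeps the constant
    positive.\<close>
  define B' where "B' = 1 + (\<Sum>i\<in>UNIV. \<Sum>j\<in>UNIV. \<bar>B i j\<bar>)"
  have B_le: "B i j \<le> B'" for i j
  proof -
    have "\<bar>B i j\<bar> \<le> (\<Sum>j\<in>UNIV. \<bar>B i j\<bar>)"
      by (rule member_le_sum) auto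
    also have "\<dots> \<le> (\<Sum>i\<in>UNIV. \<Sum>j\<in>UNIV. \<bar>B i j\<bar>)"
      by (rule member_le_sum[where f = "\<lambda>i. \<Sum>j\<in>UNIV. \<bar>B i j\<bar>"]) (auto intro: sum_nonneg)
    finally show ?thesis by (simp add: B'_def)
  qed
  have B'_pos: "B' > 0"
    unfolding B'_def by (intro add_pos_nonneg sum_nonneg) auto
  have "P $ j \<le> B' * P $ i"
    if pos: "\<forall>k. 0 < P $ k" and sub: "\<forall>k. G P $ k \<le> K * P $ k" for P i j
  proof -
    define m where "m = Min (range (($) P))"
    have "m \<in> range (($) P)" unfolding m_def by (rule Min_in) auto
    then obtain a where a: "P $ a = m" by auto
    have le: "m \<le> P $ k" for k unfolding m_def by (rule Min_le) auto
    have m: "m > 0" using a pos by metis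
    have "P $ j \<le> B a j * m" using B[OF m le, of a j] sub a by simp
    also have "\<dots> \<le> B' * m" using B_le m by (intro mult_right_mono) auto
    also have "\<dots> \<le> B' * P $ i" using le B'_pos by (intro mult_left_mono) auto
    finally show ?thesis .
  qed
  then show ?thesis using B'_pos by blast
qed

text \<open>Brouwer's theorem alone may give an eigenvector with zero entries. Those of
  \<open>G P + e *\<^sub>R 1\<close> are positive, with entries comparable uniformly in
  \<open>e\<close>, so positivity survives as \<open>e\<close> tends to 0.\<close>

lemma positive_eigenvector_exists:
  assumes mono: "monotone_on_orthant G" and conn: "strongly_connected_map G"
  shows "\<exists>P \<mu>. (\<forall>i. 0 < P $ i) \<and> G P = \<mu> *\<^sub>R P"
proof -
  let ?N = "real CARD('n)"
  let ?s = "\<lambda>P. \<Sum>i\<in>UNIV. G P $ i"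
  \<comment> \<open>Bounds the eigenvalue of every perturbation with \<open>e \<le> 1\<close>: on
    the simplex \<open>P \<le> 1\<close>, so \<open>G P \<le> G 1\<close>, and the perturbation adds
    at most \<open>?N\<close> to the sum of the entries.\<close>
  define K where "K = (\<Sum>i\<in>UNIV. G 1 $ i) + ?N"
  obtain B where B: "B > 0"
    "\<And>P i j. (\<And>k. 0 < P $ k) \<Longrightarrow> (\<And>k. G P $ k \<le> K * P $ k) \<Longrightarrow> P $ j \<le> B * P $ i"
    using strongly_connected_entries_comparable[OF mono conn, of K] by blast
  \<comment> \<open>For each \<open>e\<close> the eigenvector of \<open>G + e\<close> lies in the compact set \<open>S\<close>, which does not depend on \<open>e\<close>,
    and makes the defect \<open>?h\<close> small; so the minimum of \<open>?h\<close> on \<open>S\<close> is 0.\<close>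
  define S where "S = price_simplex \<inter> {P :: real ^ 'n. \<forall>i. 1 / (?N * B) \<le> P $ i}"
  let ?h = "\<lambda>P. \<Sum>i\<in>UNIV. \<bar>G P $ i - ?s P * P $ i\<bar>"
  have approx: "\<exists>P\<in>S. ?h P \<le> e * (2 * ?N)" if e: "0 < e" "e \<le> 1" for e
  proof -
    let ?F = "\<lambda>P. G P + e *\<^sub>R 1"
    have F_pos: "0 < ?F P $ i" if "P \<in> price_simplex" for P i
      using nonneg[of P] that price_simplex_subset_domain e
      by (auto simp: less_eq_vec_def intro: add_nonneg_pos)
    have "continuous_on price_simplex ?F"
      by (intro continuous_intros continuous_on_subset[OF cont] price_simplex_subset_domain)
    moreover have "0 \<le> ?F P" if "P \<in> price_simplex" for P
      unfolding less_eq_vec_def zero_index using F_pos[OF that] less_imp_le by blast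
    moreover have "?F P \<noteq> 0" if "P \<in> price_simplex" for P
      using F_pos[OF that, of undefined] by (metis less_irrefl zero_index)
    ultimately obtain P where P: "P \<in> price_simplex"
      and eig: "?F P = (\<Sum>i\<in>UNIV. ?F P $ i) *\<^sub>R P"
      using nonneg_eigenvector_exists[of ?F] by blast
    have P_bounds: "0 \<le> P $ i" "P $ i \<le> 1" for i
      using P price_simplex_le_1 by (auto simp: price_simplex_def less_eq_vec_def)
    have eig_i: "G P $ i + e = (?s P + ?N * e) * P $ i" for i
      using arg_cong[OF eig, of "\<lambda>x. x $ i"] by (simp add: sum.distrib)
    have pos: "0 < P $ i" for i
    proof -
      have "(?s P + ?N * e) * P $ i > 0" using F_pos[OF P, of i] eig_i[of i] by simp
      then have "P $ i \<noteq> 0" by (metis less_irrefl mult_zero_right)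
      then show ?thesis using P_bounds(1)[of i] by simp
    qed
    have "G P \<le> G 1"
      by (rule mono_onD[OF mono[unfolded monotone_on_orthant_def]])
        (use P_bounds in \<open>auto simp: less_eq_vec_def\<close>)
    then have "?s P \<le> (\<Sum>i\<in>UNIV. G 1 $ i)"
      by (intro sum_mono) (auto simp: less_eq_vec_def)
    then have sK: "?s P + ?N * e \<le> K"
      unfolding K_def using e by (intro add_mono) auto
    have sub: "G P $ i \<le> K * P $ i" for i
    proof -
      have "G P $ i \<le> (?s P + ?N * e) * P $ i" using eig_i[of i] e by simp
      also have "\<dots> \<le> K * P $ i" using sK P_bounds by (intro mult_right_mono) auto
      finally show ?thesis .
    qed
    \<comment> \<open>The entries of \<open>P\<close> sum to 1 and each is at most
      \<open>B * P $ i\<close>, hence \<open>1 \<le> ?N * B * P $ i\<close>.\<close>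
    have "1 / (?N * B) \<le> P $ i" for i
    proof -
      have "1 = (\<Sum>j\<in>UNIV. P $ j)" using P by (simp add: price_simplex_def)
      also have "\<dots> \<le> (\<Sum>j\<in>(UNIV::'n set). B * P $ i)"
        using B(2)[OF pos sub] by (intro sum_mono) auto
      finally show ?thesis using B(1) by (simp add: field_simps)
    qed
    then have "P \<in> S" using P by (simp add: S_def)
    \<comment> \<open>The eigenvector equation makes each defect \<open>e * (?N * P $ i - 1)\<close>
      before taking absolute values; as the entries of \<open>P\<close> sum to 1, the bounds here
      add up to \<open>e * (2 * ?N)\<close>.\<close>
    moreover have "?h P \<le> (\<Sum>i\<in>(UNIV::'n set). e * (?N * P $ i + 1))"
    proof (intro sum_mono)
      fix i :: 'n
      have "G P $ i - ?s P * P $ i = e * (?N * P $ i - 1)"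
        using eig_i[of i] by (simp add: algebra_simps)
      also have "\<bar>\<dots>\<bar> \<le> e * (?N * P $ i + 1)"
      proof -
        have "0 \<le> ?N * P $ i" using P_bounds(1)[of i] by simp
        then have "\<bar>?N * P $ i - 1\<bar> \<le> ?N * P $ i + 1" by linarith
        then show ?thesis using e by (simp add: abs_mult)
      qed
      finally show "\<bar>G P $ i - ?s P * P $ i\<bar> \<le> e * (?N * P $ i + 1)" .
    qed
    then have "?h P \<le> e * (2 * ?N)"
      using P by (simp add: price_simplex_def sum.distrib flip: sum_distrib_left)
    ultimately show ?thesis by blast
  qed
  have "compact S"
    unfolding S_def
    by (intro compact_Int_closed compact_price_simplex closed_Collect_all closed_Collect_le
        continuous_intros)
  moreover have "S \<noteq> {}" using approx[of 1] by auto
  moreover have "continuous_on S ?h"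
    using price_simplex_subset_domain
    by (intro continuous_intros continuous_on_subset[OF cont]) (auto simp: S_def)
  ultimately obtain P where P: "P \<in> S" and least: "\<And>Q. Q \<in> S \<Longrightarrow> ?h P \<le> ?h Q"
    using continuous_attains_inf[of S ?h] by blast
  have "?h P \<le> 0"
  proof (rule field_le_epsilon)
    fix e :: real
    assume "0 < e"
    \<comment> \<open>\<open>approx\<close> requires \<open>e' \<le> 1\<close>; the other bound
      turns its estimate into \<open>e\<close>.\<close>
    define e' where "e' = min 1 (e / (2 * ?N))"
    have "0 < e'" "e' \<le> 1" using \<open>0 < e\<close> by (auto simp: e'_def)
    then obtain Q where "Q \<in> S" "?h Q \<le> e' * (2 * ?N)" using approx by blast
    moreover have "e' * (2 * ?N) \<le> e / (2 * ?N) * (2 * ?N)"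
      by (intro mult_right_mono) (auto simp: e'_def)
    ultimately show "?h P \<le> 0 + e" using least[of Q] by simp
  qed
  then have "?h P = 0" by (intro antisym sum_nonneg) auto
  define \<mu> where "\<mu> = ?s P"
  have "\<bar>G P $ i - \<mu> * P $ i\<bar> = 0" for i
    unfolding \<mu>_def by (rule sum_nonneg_0[OF _ _ \<open>?h P = 0\<close>]) (rule finite abs_ge_zero UNIV_I)+
  then have "G P = \<mu> *\<^sub>R P" by (simp add: vec_eq_iff)
  moreover have "0 < P $ i" for i
  proof -
    have "0 < 1 / (?N * B)" using B(1) by simp
    also have "\<dots> \<le> P $ i" using P by (simp add: S_def)
    finally show ?thesis .
  qed
  ultimately show ?thesis by blast
qed

section \<open>Fixed points of indecomposable maps\<close>

lemma indecomposable_fixed_point_positive: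
  assumes indec: "indecomposable_map G" and zero: "G 0 = 0"
    and P: "P \<in> price_domain" "G P = P"
  shows "0 < P $ i"
proof (rule ccontr)
  assume "\<not> 0 < P $ i"
  \<comment> \<open>For the pair \<open>P\<close>, \<open>0\<close> the set \<open>\<Omega>\<close>
    is the support of \<open>P\<close>. Were it proper, some \<open>k\<close> outside it would have
    \<open>G P $ k \<noteq> 0\<close>, while \<open>G P $ k = P $ k = 0\<close>.\<close>
  then have "{j. (0 :: real ^ 'n) $ j < P $ j} \<noteq> UNIV" by auto
  moreover have "{j. (0 :: real ^ 'n) $ j < P $ j} \<noteq> {}"
    using P(1) by (force simp: price_domain_def less_eq_vec_def vec_eq_iff order_less_le)
  ultimately obtain k where "\<not> 0 < P $ k" "G P $ k \<noteq> G 0 $ k"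
    using indec[unfolded indecomposable_map_def Let_def, rule_format, of 0 P] P(1)
    by (auto simp: price_domain_def)
  then show False
    using P zero by (auto simp: price_domain_def less_eq_vec_def order_less_le)
qed

text \<open>The largest multiple \<open>t *\<^sub>R P\<close> below \<open>Q\<close> touches
  \<open>Q\<close> in some entry and is again a fixed point. If it differed from \<open>Q\<close>
  elsewhere, indecomposability would separate the images at an index where the two fixed points
  agree.\<close>

lemma indecomposable_fixed_point_unique:
  assumes indec: "indecomposable_map G"
    and P: "\<And>i. 0 < P $ i" "G P = P" and Q: "\<And>i. 0 < Q $ i" "G Q = Q"
  shows "\<exists>t>0. Q = t *\<^sub>R P"
proof -
  define t where "t = Min (range (\<lambda>i. Q $ i / P $ i))"
  have "t \<in> range (\<lambda>i. Q $ i / P $ i)" unfolding t_def by (rule Min_in) auto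
  then obtain a where a: "t = Q $ a / P $ a" by auto
  then have t: "t > 0" using P(1) Q(1) by simp
  have "t \<le> Q $ i / P $ i" for i unfolding t_def by (rule Min_le) auto
  then have le: "t *\<^sub>R P \<le> Q" using P(1) by (simp add: less_eq_vec_def field_simps)
  have "P \<in> price_domain"
    by (rule positive_in_domain) (fact P(1))
  then have Gt: "G (t *\<^sub>R P) = t *\<^sub>R P" using scale t P(2) by simp
  have ge0: "0 \<le> t *\<^sub>R P" using t P(1) by (simp add: less_eq_vec_def less_imp_le)
  let ?\<Omega> = "{j. (t *\<^sub>R P) $ j < Q $ j}"
  have "a \<notin> ?\<Omega>" using a P(1)[of a] by simp
  then have "?\<Omega> \<noteq> UNIV" by blast
  have "?\<Omega> = {}"
  proof (rule ccontr)
    assume "?\<Omega> \<noteq> {}"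
    then obtain k where "k \<notin> ?\<Omega>" "G Q $ k \<noteq> G (t *\<^sub>R P) $ k"
      using indec[unfolded indecomposable_map_def Let_def, rule_format, of "t *\<^sub>R P" Q]
        ge0 le \<open>?\<Omega> \<noteq> UNIV\<close> by blast
    then show False using le Gt Q(2) by (auto simp: less_eq_vec_def order_less_le)
  qed
  then have "Q \<le> t *\<^sub>R P" by (auto simp: less_eq_vec_def not_less)
  then show ?thesis using le t by (metis antisym)
qed

end

section \<open>The price system and its reduction to a fixed point problem\<close>

locale price_system =
  fixes p q :: "real ^ 'm ^ 'n"
    and c d :: "('n::finite, 'm::finite) coeff_family"
    and r :: real
  assumes c_nonneg: "\<And>i j P. P \<in> price_domain \<Longrightarrow> c i j P p q \<ge> 0"
    and d_nonneg: "\<And>i j P. P \<in> price_domain \<Longrightarrow> d i j P p q \<ge> 0"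
    and c_cont: "\<And>i j. continuous_on price_domain (\<lambda>P. c i j P p q)"
    and d_cont: "\<And>i j. continuous_on price_domain (\<lambda>P. d i j P p q)"
    and c_hom: "homogeneous_on_prices r c p q"
    and d_hom: "homogeneous_on_prices r d p q"
    and nondeg: "nondegenerate c d p q"
begin

abbreviation C :: "'m \<Rightarrow> real ^ 'n \<Rightarrow> real" where
  "C j P \<equiv> \<Sum>k\<in>UNIV. c k j P p q"

abbreviation D :: "'n \<Rightarrow> real ^ 'n \<Rightarrow> real" where
  "D i P \<equiv> \<Sum>m\<in>UNIV. d i m P p q"

abbreviation G :: "real ^ 'n \<Rightarrow> real ^ 'n" where
  "G \<equiv> G_map c d p q"

text \<open>The values \<open>1/PPP_j\<close> that the first group of equations determines from
  \<open>P\<close>.\<close>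

definition U :: "real ^ 'n \<Rightarrow> real ^ 'm" where
  "U P = (\<chi> j. \<Sum>n\<in>UNIV. d n j P p q / C j P * P $ n)"

lemma C_pos: "P \<in> price_domain \<Longrightarrow> 0 < C j P"
  and D_pos: "P \<in> price_domain \<Longrightarrow> 0 < D i P"
  using nondeg by (auto simp: nondegenerate_def)

lemma G_nth: "P \<in> price_domain \<Longrightarrow> G P $ i = (\<Sum>m\<in>UNIV. c i m P p q * U P $ m) / D i P"
  by (simp add: G_map_def U_def price_domain_def)

lemma U_nonneg: "P \<in> price_domain \<Longrightarrow> 0 \<le> U P"
  unfolding less_eq_vec_def U_def
  by (auto intro!: sum_nonneg mult_nonneg_nonneg divide_nonneg_pos C_pos d_nonneg)
    (auto simp: price_domain_def less_eq_vec_def)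

text \<open>For strictly positive \<open>P\<close> the column sums of \<open>d\<close> are positive,
  so each entry of \<open>U P\<close> has a positive summand.\<close>

lemma U_pos:
  assumes P: "\<And>i. 0 < P $ i"
  shows "0 < U P $ j"
proof -
  have dom: "P \<in> price_domain"
    by (rule positive_in_domain) (fact P)
  have "(\<Sum>i\<in>UNIV. d i j P p q) \<noteq> 0"
    using nondeg P unfolding nondegenerate_def by (metis less_irrefl)
  then obtain n where "d n j P p q \<noteq> 0" by (meson sum.neutral)
  then have "0 < d n j P p q" using d_nonneg[OF dom] by (simp add: order_less_le)
  then have "0 < d n j P p q / C j P * P $ n"
    using C_pos[OF dom] P by (intro mult_pos_pos divide_pos_pos)
  moreover have "0 \<le> d i j P p q / C j P * P $ i" for i
    using C_pos[OF dom] P d_nonneg[OF dom]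
    by (intro mult_nonneg_nonneg divide_nonneg_pos less_imp_le[OF P])
  ultimately have "0 < (\<Sum>n\<in>UNIV. d n j P p q / C j P * P $ n)"
    by (intro sum_pos2[of _ n]) auto
  then show ?thesis by (simp add: U_def)
qed

text \<open>The factors \<open>t powr r\<close> of \<open>d\<close> and \<open>C\<close> cancel,
  which leaves degree one for every \<open>r\<close>.\<close>

lemma U_scale:
  assumes "P \<in> price_domain" "t > 0"
  shows "U (t *\<^sub>R P) = t *\<^sub>R U P"
proof -
  have *: "c i j (t *\<^sub>R P) p q = t powr r * c i j P p q"
    "d i j (t *\<^sub>R P) p q = t powr r * d i j P p q" for i j
    using assms c_hom d_hom by (auto simp: homogeneous_on_prices_def)
  have "d n j (t *\<^sub>R P) p q / C j (t *\<^sub>R P) * (t *\<^sub>R P) $ n = t * (d n j P p q / C j P * P $ n)"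
    for n j
    unfolding * sum_distrib_left[symmetric] using assms(2) by simp
  then show ?thesis by (simp only: U_def vec_eq_iff vec_lambda_beta vector_scaleR_component
        sum_distrib_left real_scaleR_def simp_thms)
qed

text \<open>Substituting \<open>u = U P\<close> into the second group of equations and pulling the
  division by \<open>D i P\<close> out of the sum leaves \<open>P = G P\<close>.\<close>

lemma is_solution_iff:
  assumes "P \<in> price_domain"
  shows "is_solution c d p q u P \<longleftrightarrow> u = U P \<and> G P = P"
proof -
  have "(\<Sum>m\<in>UNIV. c i m P p q / D i P * U P $ m) = G P $ i" for i
    using G_nth[OF assms] by (simp add: sum_divide_distrib)
  then have G: "(\<forall>i. P $ i = (\<Sum>m\<in>UNIV. c i m P p q / D i P * U P $ m)) \<longleftrightarrow> G P = P"
    by (metis vec_eq_iff)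
  have u: "(\<forall>j. u $ j = (\<Sum>n\<in>UNIV. d n j P p q / C j P * P $ n)) \<longleftrightarrow> u = U P"
    by (simp add: U_def vec_eq_iff)
  have "P \<noteq> 0" using assms by (simp add: price_domain_def)
  then show ?thesis unfolding is_solution_def u using G by blast
qed

lemma G_scale:
  assumes P: "P \<in> price_domain" and t: "t > 0"
  shows "G (t *\<^sub>R P) = t *\<^sub>R G P"
proof -
  have *: "c i j (t *\<^sub>R P) p q = t powr r * c i j P p q"
    "d i j (t *\<^sub>R P) p q = t powr r * d i j P p q" for i j
    using assms c_hom d_hom by (auto simp: homogeneous_on_prices_def)
  have "t *\<^sub>R P \<in> price_domain"
    using assms by (auto simp: price_domain_def less_eq_vec_def)
  moreover have "(\<Sum>m\<in>UNIV. c i m (t *\<^sub>R P) p q * U (t *\<^sub>R P) $ m) =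
      t powr r * (t * (\<Sum>m\<in>UNIV. c i m P p q * U P $ m))" for i
    by (simp add: * U_scale[OF assms] sum_distrib_left mult_ac)
  moreover have "D i (t *\<^sub>R P) = t powr r * D i P" for i
    by (simp add: * sum_distrib_left)
  ultimately show ?thesis
    using assms by (simp add: vec_eq_iff G_nth)
qed

lemma G_cont: "continuous_on price_domain G"
proof -
  have *: "(\<Sum>m\<in>UNIV. d i m P p q) \<noteq> 0" "(\<Sum>k\<in>UNIV. c k j P p q) \<noteq> 0"
    if "P \<in> price_domain" for P i j
    using C_pos[OF that, of j] D_pos[OF that, of i] by auto
  have "continuous_on price_domain (\<lambda>P. \<chi> i. (\<Sum>m\<in>UNIV. c i m P p q * U P $ m) / D i P)"
    unfolding U_def
    by (intro continuous_on_vec_lambda) (auto intro!: continuous_intros c_cont d_cont *)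
  then show ?thesis
    by (rule continuous_on_cong[THEN iffD1, rotated -1]) (auto simp: vec_eq_iff G_nth)
qed

lemma G_nonneg: "P \<in> price_domain \<Longrightarrow> 0 \<le> G P"
  using U_nonneg[of P] unfolding less_eq_vec_def
  by (simp add: G_nth D_pos c_nonneg divide_nonneg_pos sum_nonneg)

sublocale homogeneous_map G
  using G_scale G_cont G_nonneg by unfold_locales

section \<open>Conservation of value and the eigenvalue 1\<close>

lemma conservation:
  assumes P: "P \<in> price_domain"
  shows "(\<Sum>i\<in>UNIV. D i P * G P $ i) = (\<Sum>i\<in>UNIV. D i P * P $ i)"
proof -
  \<comment> \<open>The weight \<open>D i P\<close> cancels the denominator of
    \<open>G P $ i\<close>.\<close>
  have "(\<Sum>i\<in>UNIV. D i P * G P $ i) = (\<Sum>i\<in>UNIV. \<Sum>m\<in>UNIV. c i m P p q * U P $ m)"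
    using D_pos[OF P] by (simp add: G_nth[OF P] less_imp_neq[THEN not_sym])
  also have "\<dots> = (\<Sum>m\<in>UNIV. C m P * U P $ m)"
    by (subst sum.swap) (simp add: sum_distrib_right)
  \<comment> \<open>After the exchange of sums \<open>C m P\<close> cancels the denominator in
    \<open>U P $ m\<close>.\<close>
  also have "\<dots> = (\<Sum>m\<in>UNIV. \<Sum>n\<in>UNIV. d n m P p q * P $ n)"
    using C_pos[OF P]
    by (simp add: U_def sum_divide_distrib[symmetric] less_imp_neq[THEN not_sym])
  also have "\<dots> = (\<Sum>n\<in>UNIV. D n P * P $ n)"
    by (subst sum.swap) (simp add: sum_distrib_right)
  finally show ?thesis .
qed

lemma value_pos:
  assumes P: "P \<in> price_domain"
  shows "0 < (\<Sum>i\<in>UNIV. D i P * P $ i)"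
proof -
  obtain i where "P $ i \<noteq> 0" using P by (auto simp: price_domain_def vec_eq_iff)
  then have "0 < P $ i" using P by (auto simp: price_domain_def less_eq_vec_def order_less_le)
  then show ?thesis
    using P D_pos[OF P]
    by (intro sum_pos2[of _ i]) (auto simp: price_domain_def less_eq_vec_def less_imp_le)
qed

text \<open>If \<open>G P\<close> vanished, the conserved value would be 0, but it is
  positive.\<close>

lemma G_nonzero: "P \<in> price_domain \<Longrightarrow> G P \<noteq> 0"
  using conservation[of P] value_pos[of P] by auto

text \<open>Conservation equates \<open>\<mu>\<close> times the value of \<open>P\<close> with the
  value itself, which is positive and can be cancelled.\<close>

lemma eigenvector_fixed:
  assumes P: "P \<in> price_domain" and eig: "G P = \<mu> *\<^sub>R P"
  shows "G P = P"
proof -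
  have "\<mu> * (\<Sum>i\<in>UNIV. D i P * P $ i) = (\<Sum>i\<in>UNIV. D i P * P $ i)"
    using conservation[OF P] unfolding eig by (simp add: sum_distrib_left mult_ac)
  then have "\<mu> = 1" using value_pos[OF P] by simp
  then show ?thesis using eig by simp
qed

lemma fixed_point_exists: "\<exists>P \<in> price_domain. G P = P"
proof -
  have dom: "P \<in> price_domain" if "P \<in> price_simplex" for P :: "real ^ 'n"
    using that price_simplex_subset_domain by blast
  obtain P where "P \<in> price_simplex" "G P = (\<Sum>i\<in>UNIV. G P $ i) *\<^sub>R P"
    using nonneg_eigenvector_exists[OF
        continuous_on_subset[OF cont price_simplex_subset_domain] nonneg[OF dom] G_nonzero[OF dom]]
    by metis
  then show ?thesis using eigenvector_fixed[OF dom] dom by metis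
qed

lemma nonneg_solutionI: "P \<in> price_domain \<Longrightarrow> G P = P \<Longrightarrow> nonneg_solution c d p q (U P) P"
  using U_nonneg[of P] is_solution_iff[of P "U P"]
  unfolding nonneg_solution_def price_domain_def less_eq_vec_def by simp

text \<open>Positivity of \<open>u\<close> follows from that of \<open>P\<close> by
  \<open>U_pos\<close>.\<close>

lemma positive_solution_iff:
  "positive_solution c d p q u P \<longleftrightarrow> (\<forall>i. 0 < P $ i) \<and> u = U P \<and> G P = P"
  unfolding positive_solution_def using positive_in_domain is_solution_iff U_pos by blast

end

theorem theorem3:
  fixes p q :: "real ^ 'm ^ 'n"
    and c d :: "('n::finite, 'm::finite) coeff_family"
    and r :: real
  assumes p_pos: "\<And>i j. p $ i $ j > 0"
    and q_nonneg: "\<And>i j. q $ i $ j \<ge> 0"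
    and c_nonneg: "\<And>i j P. P \<in> price_domain \<Longrightarrow> c i j P p q \<ge> 0"
    and d_nonneg: "\<And>i j P. P \<in> price_domain \<Longrightarrow> d i j P p q \<ge> 0"
    and c_cont: "\<And>i j. continuous_on price_domain (\<lambda>P. c i j P p q)"
    and d_cont: "\<And>i j. continuous_on price_domain (\<lambda>P. d i j P p q)"
    and c_hom: "homogeneous_on_prices r c p q"
    and d_hom: "homogeneous_on_prices r d p q"
    and nondeg: "nondegenerate c d p q"
  shows "(\<exists>u P. nonneg_solution c d p q u P) \<and>
    (monotone_on_orthant (G_map c d p q) \<and> strongly_connected_map (G_map c d p q) \<longrightarrow>
       (\<exists>u P. positive_solution c d p q u P)) \<and>
    (monotone_on_orthant (G_map c d p q) \<and> indecomposable_map (G_map c d p q) \<longrightarrow>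
       (\<exists>u P. positive_solution c d p q u P) \<and>
       (\<forall>u P u' P'. positive_solution c d p q u P \<and> positive_solution c d p q u' P' \<longrightarrow>
          (\<exists>t>0. u' = t *\<^sub>R u \<and> P' = t *\<^sub>R P)))"
proof -
  interpret price_system p q c d r
    by unfold_locales (fact c_nonneg d_nonneg c_cont d_cont c_hom d_hom nondeg)+
  \<comment> \<open>This fixed point proves (i) and, once shown positive, also the existence claim
    of (iii).\<close>
  obtain P\<^sub>0 where P\<^sub>0: "P\<^sub>0 \<in> price_domain" "G P\<^sub>0 = P\<^sub>0" using fixed_point_exists by blast
  show ?thesis
  proof (intro conjI impI allI)
    show "\<exists>u P. nonneg_solution c d p q u P" using nonneg_solutionI[OF P\<^sub>0] by blast
  next
    assume "monotone_on_orthant G \<and> strongly_connected_map G"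
    then obtain P \<mu> where P: "\<forall>i. 0 < P $ i" "G P = \<mu> *\<^sub>R P"
      using positive_eigenvector_exists by blast
    then have "G P = P" using eigenvector_fixed[OF positive_in_domain] by blast
    then show "\<exists>u P. positive_solution c d p q u P" using P(1) positive_solution_iff by blast
  next
    assume "monotone_on_orthant G \<and> indecomposable_map G"
    then have "\<forall>i. 0 < P\<^sub>0 $ i"
      using indecomposable_fixed_point_positive[OF _ _ P\<^sub>0] by (simp add: G_map_def)
    then show "\<exists>u P. positive_solution c d p q u P" using P\<^sub>0 positive_solution_iff by blast
  next
    fix u P u' P'
    assume indec: "monotone_on_orthant G \<and> indecomposable_map G"
      and "positive_solution c d p q u P \<and> positive_solution c d p q u' P'"
    then have sol: "\<And>i. 0 < P $ i" "u = U P" "G P = P" "\<And>i. 0 < P' $ i" "u' = U P'" "G P' = P'"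
      by (auto simp: positive_solution_iff)
    then obtain t where "t > 0" "P' = t *\<^sub>R P"
      using indecomposable_fixed_point_unique indec by metis
    then show "\<exists>t>0. u' = t *\<^sub>R u \<and> P' = t *\<^sub>R P"
      \<comment> \<open>Both parts of the solution scale by the same \<open>t\<close> because
        \<open>U\<close> is homogeneous of degree one.\<close>
      using U_scale[OF positive_in_domain] sol by blast
  qed
qed

end
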